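(* Let $\mathcal{X},\mathcal{Y}$ be finite alphabets. For any joint distribution $P_{XY}$ on $\mathcal{X}\times\mathcal{Y}$, the maximal gain leakage equals the maximal leakage: $\mathcal{L}(X\to Y)=\mathcal{L}_G(X\to Y)$.
   Context: $\log$ is the natural logarithm. Dashes denote Markov chains. The maximal leakage is $$\mathcal{L}(X\to Y)=\sup_{U-X-Y-\hat U}\log\frac{\Pr(U=\hat U)}{\max_{u}P_U(u)},$$ the supremum being over all $U,\hat U$ taking values in the same finite, but arbitrary, alphabet. The maximal gain leakage is $$\mathcal{L}_G(X\to Y)=\sup\ \log\frac{\sup_{\hat u(\cdot)}\mathbf{E}[g(U,\hat u(Y))]}{\sup_{\hat u\in\hat{\mathcal{U}}}\mathbf{E}[g(U,\hat u)]},$$ where the outer supremum is over all random variables $U$ with $U-X-Y$ taking values in a finite, but arbitrary, alphabet $\mathcal{U}$, all (non-empty) sets $\hat{\mathcal{U}}$, and all functions $g:\mathcal{U}\times\hat{\mathcal{U}}\to[0,\infty)$ with $\sup_{\hat u\in\hat{\mathcal{U}}}\mathbf{E}[g(U,\hat u)]>0$; $\hat u(\cdot)$ ranges over functions $\mathcal{Y}\to\hat{\mathcal{U}}$. *)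

theory Defs
  imports "HOL-Probability.Probability" "HOL-Library.Infinite_Typeclass"
begin

text \<open>
  The library's \<open>ln\<close> on the reals satisfies \<open>ln 0 = 0\<close>; the suprema below need \<open>log 0 = -\<infinity>\<close>.
\<close>

definition ext_ln :: "ereal \<Rightarrow> ereal" where
  "ext_ln r = (if r \<le> 0 then -\<infinity> else if r = \<infinity> then \<infinity> else ereal (ln (real_of_ereal r)))"

text \<open>
  \<open>markov_chain Q\<close>: if \<open>(A, B, C)\<close> has joint law \<open>Q\<close>, then \<open>A\<close> and \<open>C\<close> are conditionally
  independent given \<open>B\<close>, written without division as
  \<open>Pr(a,b,c) * Pr(b) = Pr(a,b) * Pr(b,c)\<close>.
  In a chain \<open>A - B - C - D\<close>, moreover \<open>(A, B)\<close> and \<open>D\<close> are conditionally independent given \<open>C\<close>.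
\<close>

definition markov_chain :: "('a \<times> 'b \<times> 'c) pmf \<Rightarrow> bool" where
  "markov_chain Q \<longleftrightarrow>
     (\<forall>a b c. pmf Q (a, b, c) * pmf (map_pmf (\<lambda>(a, b, c). b) Q) b =
        pmf (map_pmf (\<lambda>(a, b, c). (a, b)) Q) (a, b) * pmf (map_pmf (\<lambda>(a, b, c). (b, c)) Q) (b, c))"

definition markov_chain4 :: "('a \<times> 'b \<times> 'c \<times> 'd) pmf \<Rightarrow> bool" where
  "markov_chain4 Q \<longleftrightarrow>
     markov_chain (map_pmf (\<lambda>(a, b, c, d). (a, b, c)) Q) \<and>
     markov_chain (map_pmf (\<lambda>(a, b, c, d). ((a, b), c, d)) Q)"

text \<open>
  Random variables \<open>U\<close> (and \<open>U'\<close>) jointly distributed with \<open>(X, Y)\<close> are given by the joint law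
  \<open>Q\<close> of \<open>(U, X, Y, U')\<close>, resp. \<open>(U, X, Y)\<close>, whose marginal on \<open>(X, Y)\<close> is \<open>P\<close>.
  The finite alphabets \<open>A\<close> of \<open>U\<close> are, up to relabelling, finite sets of natural numbers.
\<close>

definition maximal_leakage :: "('x::finite \<times> 'y::finite) pmf \<Rightarrow> ereal" where
  "maximal_leakage P = Sup {
     ext_ln (ereal (measure_pmf.prob Q {(u, x, y, u'). u = u'} /
                    Max ((\<lambda>u. pmf (map_pmf fst Q) u) ` A)))
     | (A :: nat set) (Q :: (nat \<times> 'x \<times> 'y \<times> nat) pmf).
         finite A \<and> set_pmf Q \<subseteq> A \<times> UNIV \<times> UNIV \<times> A \<and>
         map_pmf (\<lambda>(u, x, y, u'). (x, y)) Q = P \<and> markov_chain4 Q}"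

definition expected_gain ::
    "(nat \<times> 'x::finite \<times> 'y::finite) pmf \<Rightarrow> (nat \<Rightarrow> 'b \<Rightarrow> real) \<Rightarrow> ('y \<Rightarrow> 'b) \<Rightarrow> ereal" where
  "expected_gain Q g h = ereal (measure_pmf.expectation Q (\<lambda>(u, x, y). g u (h y)))"

text \<open>
  The guess set \<open>W\<close> may have any cardinality and cannot be quantified over all types inside one
  definition. Hence \<open>W\<close> ranges over the non-empty subsets of an ambient type \<open>'b\<close>, recorded as
  an argument; \<open>'b\<close> is infinite, so that it contains at least a copy of every finite set.

  Both suprema in the quotient may be infinite. If the denominator is \<open>\<infinity>\<close>, so is the numerator,
  and \<open>\<infinity> / \<infinity> = 0\<close> in \<^typ>\<open>ereal\<close>: such \<open>g\<close>, whose quotient is undefined, contribute \<open>-\<infinity>\<close>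
  to the outer supremum, that is, nothing.
\<close>

definition maximal_gain_leakage ::
    "'b::infinite itself \<Rightarrow> ('x::finite \<times> 'y::finite) pmf \<Rightarrow> ereal" where
  "maximal_gain_leakage T P = Sup {
     ext_ln ((SUP h\<in>{h. range h \<subseteq> W}. expected_gain Q g h) /
             (SUP w\<in>W. expected_gain Q g (\<lambda>_. w)))
     | (A :: nat set) (Q :: (nat \<times> 'x \<times> 'y) pmf) (W :: 'b set) (g :: nat \<Rightarrow> 'b \<Rightarrow> real).
         finite A \<and> set_pmf Q \<subseteq> A \<times> UNIV \<times> UNIV \<and>
         map_pmf (\<lambda>(u, x, y). (x, y)) Q = P \<and> markov_chain Q \<and>
         W \<noteq> {} \<and> (\<forall>u\<in>A. \<forall>w\<in>W. 0 \<le> g u w) \<and>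
         0 < (SUP w\<in>W. expected_gain Q g (\<lambda>_. w))}"

end

(* Both quantities equal ln K, where K is the sum over y of the maximum of P(y|x) over the x with
   P(x) > 0. By the Markov property, P(u,x,y) <= P(u,x) max_x P(y|x), which bounds every gain
   quotient by K. Conversely, the leakage attains K when U splits X into pieces of probability at
   most p = min_x P(x), one piece of each x having probability exactly p. Finally, guessing U
   itself is the case of an indicator gain function. *)
theory Submission
  imports Defs
begin

section \<open>Finite marginals, Markov factorisations and maximal likelihoods\<close>

lemma ext_ln_mono: "r \<le> s \<Longrightarrow> ext_ln r \<le> ext_ln s"
  by (cases r; cases s) (auto simp: ext_ln_def)

text \<open>The map \<open>i\<close> enumerates a finite set of points of the fibre over
  \<open>z\<close> that contains all those of positive mass. Null points may be included, so
  marginals of a finitely supported law on an infinite type become sums over any convenient finite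
  box.\<close>

lemma pmf_map_eq_sum:
  assumes "finite S" "inj_on i S" "\<And>s. s \<in> S \<Longrightarrow> f (i s) = z"
    and "\<And>q. q \<in> set_pmf Q \<Longrightarrow> f q = z \<Longrightarrow> q \<in> i ` S"
  shows "pmf (map_pmf f Q) z = (\<Sum>s\<in>S. pmf Q (i s))"
proof -
  have "pmf (map_pmf f Q) z = measure_pmf.prob Q (f -` {z})"
    by (simp add: pmf_map)
  also have "\<dots> = measure_pmf.prob Q (i ` S)"
    by (rule measure_prob_cong_0) (use assms in \<open>auto simp: set_pmf_iff\<close>)
  also have "\<dots> = (\<Sum>s\<in>S. pmf Q (i s))"
    using assms by (simp add: measure_measure_pmf_finite sum.reindex)
  finally show ?thesis .
qed

lemma pmf_marginals:
  fixes Q :: "('a \<times> 'b \<times> 'c) pmf"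
  assumes "finite A" "finite C" "set_pmf Q \<subseteq> A \<times> UNIV \<times> C"
  shows "pmf (map_pmf (\<lambda>(a, b, c). b) Q) b = (\<Sum>a\<in>A. \<Sum>c\<in>C. pmf Q (a, b, c))"
    and "pmf (map_pmf (\<lambda>(a, b, c). (a, b)) Q) (a, b) = (\<Sum>c\<in>C. pmf Q (a, b, c))"
    and "pmf (map_pmf (\<lambda>(a, b, c). (b, c)) Q) (b, c) = (\<Sum>a\<in>A. pmf Q (a, b, c))"
proof -
  have "pmf (map_pmf (\<lambda>(a, b, c). b) Q) b = (\<Sum>s\<in>A \<times> C. pmf Q ((\<lambda>(a, c). (a, b, c)) s))"
    by (rule pmf_map_eq_sum) (use assms in \<open>auto simp: inj_on_def\<close>)
  then show "pmf (map_pmf (\<lambda>(a, b, c). b) Q) b = (\<Sum>a\<in>A. \<Sum>c\<in>C. pmf Q (a, b, c))"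
    by (simp add: sum.cartesian_product case_prod_unfold)
  show "pmf (map_pmf (\<lambda>(a, b, c). (a, b)) Q) (a, b) = (\<Sum>c\<in>C. pmf Q (a, b, c))"
    by (rule pmf_map_eq_sum) (use assms in \<open>auto simp: inj_on_def\<close>)
  show "pmf (map_pmf (\<lambda>(a, b, c). (b, c)) Q) (b, c) = (\<Sum>a\<in>A. pmf Q (a, b, c))"
    by (rule pmf_map_eq_sum) (use assms in \<open>auto simp: inj_on_def\<close>)
qed

text \<open>Summing out coordinates turns both sides of the Markov identity into
  \<open>f a b * h b c\<close> times the sum of \<open>f\<close> over its first argument times the
  sum of \<open>h\<close> over its second. The factors may be unnormalised.\<close>

lemma markov_chain_factor:
  fixes Q :: "('a \<times> 'b \<times> 'c) pmf"
  assumes "finite A" "finite C" "set_pmf Q \<subseteq> A \<times> UNIV \<times> C"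
    and "\<And>a b c. pmf Q (a, b, c) = f a b * h b c"
  shows "markov_chain Q"
  unfolding markov_chain_def pmf_marginals[OF assms(1-3)] assms(4)
  by (simp add: sum_distrib_left[symmetric] sum_distrib_right[symmetric] mult_ac)

text \<open>The logarithm of the sum of these values over \<open>y\<close> is the Sibson mutual
  information of order infinity.\<close>

definition maximal_likelihood :: "('x::finite \<times> 'y::finite) pmf \<Rightarrow> 'y \<Rightarrow> real" where
  "maximal_likelihood P y =
     Max ((\<lambda>x. pmf P (x, y) / pmf (map_pmf fst P) x) ` set_pmf (map_pmf fst P))"

lemma likelihood_le:
  assumes "x \<in> set_pmf (map_pmf fst P)"
  shows "pmf P (x, y) / pmf (map_pmf fst P) x \<le> maximal_likelihood P y"
  unfolding maximal_likelihood_def using assms by (intro Max_ge) auto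

lemma maximal_likelihood_attained:
  "\<exists>x\<in>set_pmf (map_pmf fst P). maximal_likelihood P y = pmf P (x, y) / pmf (map_pmf fst P) x"
proof -
  have "maximal_likelihood P y \<in>
      (\<lambda>x. pmf P (x, y) / pmf (map_pmf fst P) x) ` set_pmf (map_pmf fst P)"
    unfolding maximal_likelihood_def by (intro Max_in) (auto simp: set_pmf_not_empty)
  then show ?thesis by blast
qed

lemma maximal_likelihood_nonneg: "0 \<le> maximal_likelihood P y"
  using maximal_likelihood_attained[of P y] by auto

section \<open>Upper bound on the gain leakage\<close>

lemma expected_gain_eq_sum:
  fixes Q :: "(nat \<times> 'x::finite \<times> 'y::finite) pmf"
  assumes "finite A" "set_pmf Q \<subseteq> A \<times> UNIV \<times> UNIV"
  shows "expected_gain Q g h = ereal (\<Sum>y\<in>UNIV. \<Sum>u\<in>A. \<Sum>x\<in>UNIV. g u (h y) * pmf Q (u, x, y))"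
proof -
  have "measure_pmf.expectation Q (\<lambda>(u, x, y). g u (h y)) =
      (\<Sum>q\<in>A \<times> UNIV \<times> UNIV. (\<lambda>(u, x, y). g u (h y)) q * pmf Q q)"
    by (rule integral_measure_pmf_real) (use assms in auto)
  also have "\<dots> = (\<Sum>u\<in>A. \<Sum>x\<in>UNIV. \<Sum>y\<in>UNIV. g u (h y) * pmf Q (u, x, y))"
    by (simp add: sum.cartesian_product case_prod_unfold)
  also have "\<dots> = (\<Sum>y\<in>UNIV. \<Sum>u\<in>A. \<Sum>x\<in>UNIV. g u (h y) * pmf Q (u, x, y))"
    by (subst sum.swap[of _ UNIV UNIV], subst sum.swap[of _ UNIV A]) simp
  finally show ?thesis by (simp add: expected_gain_def)
qed

text \<open>The Markov identity is divided by the probability of \<open>x\<close> where this is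
  positive; elsewhere the left-hand side vanishes. The resulting factor depends on \<open>y\<close>
  alone, so it can be pulled out of sums over \<open>u\<close> and \<open>x\<close>.\<close>

lemma markov_chain_joint_le:
  fixes Q :: "(nat \<times> 'x::finite \<times> 'y::finite) pmf"
  assumes A: "finite A" "set_pmf Q \<subseteq> A \<times> UNIV \<times> UNIV"
    and P: "map_pmf (\<lambda>(u, x, y). (x, y)) Q = P" and Q: "markov_chain Q"
  shows "pmf Q (u, x, y) \<le> (\<Sum>y\<in>UNIV. pmf Q (u, x, y)) * maximal_likelihood P y"
proof -
  have PX: "map_pmf (\<lambda>(u, x, y). x) Q = map_pmf fst P"
    by (simp add: P[symmetric] pmf.map_comp o_def case_prod_unfold)
  have eq: "pmf Q (u, x, y) * pmf (map_pmf fst P) x = (\<Sum>y\<in>UNIV. pmf Q (u, x, y)) * pmf P (x, y)"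
    using Q[unfolded markov_chain_def, rule_format, of u x y]
    unfolding PX P pmf_marginals(2)[OF A(1) finite A(2)] .
  show ?thesis
  proof (cases "x \<in> set_pmf (map_pmf fst P)")
    case True
    then have "pmf (map_pmf fst P) x > 0" by (simp add: pmf_positive)
    then have "pmf Q (u, x, y) = (\<Sum>y\<in>UNIV. pmf Q (u, x, y)) * (pmf P (x, y) / pmf (map_pmf fst P) x)"
      using eq by (simp add: field_simps)
    also have "\<dots> \<le> (\<Sum>y\<in>UNIV. pmf Q (u, x, y)) * maximal_likelihood P y"
      by (intro mult_left_mono likelihood_le True sum_nonneg) auto
    finally show ?thesis .
  next
    case False
    then have "(u, x, y) \<notin> set_pmf Q"
      unfolding PX[symmetric] by force
    then have "pmf Q (u, x, y) = 0" by (simp add: set_pmf_iff)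
    then show ?thesis
      by (simp add: maximal_likelihood_nonneg sum_nonneg)
  qed
qed

lemma maximal_gain_leakage_le:
  fixes P :: "('x::finite \<times> 'y::finite) pmf"
  shows "maximal_gain_leakage TYPE('b::infinite) P \<le> ext_ln (\<Sum>y\<in>UNIV. maximal_likelihood P y)"
  unfolding maximal_gain_leakage_def
proof (rule Sup_least, clarsimp simp only: mem_Collect_eq)
  fix A :: "nat set" and Q :: "(nat \<times> 'x \<times> 'y) pmf" and W :: "'b set" and g :: "nat \<Rightarrow> 'b \<Rightarrow> real"
  assume A: "finite A" "set_pmf Q \<subseteq> A \<times> UNIV \<times> UNIV"
    and P: "P = map_pmf (\<lambda>(u, x, y). (x, y)) Q" and Q: "markov_chain Q"
    and W: "W \<noteq> {}" and g: "\<forall>u\<in>A. \<forall>w\<in>W. 0 \<le> g u w"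
    and pos: "0 < (SUP w\<in>W. expected_gain Q g (\<lambda>_. w))"
  define D where "D = (SUP w\<in>W. expected_gain Q g (\<lambda>_. w))"
  define V where "V = maximal_likelihood P"
  have "(SUP h\<in>{h. range h \<subseteq> W}. expected_gain Q g h) / D \<le> ereal (\<Sum>y\<in>UNIV. V y)"
  proof (cases D)
    case (real d)
    with pos have d: "d > 0" by (simp add: D_def)
    have "expected_gain Q g h \<le> ereal ((\<Sum>y\<in>UNIV. V y) * d)" if h: "range h \<subseteq> W" for h
    proof -
      \<comment> \<open>The slice \<open>Y = y\<close> of the gain of \<open>h\<close> is compared
        with the full gain of the constant guess \<open>h y\<close>, which is at most
        \<open>d\<close>. Nonnegativity of \<open>g\<close> lets the joint bound be applied
        termwise.\<close>
      have "(\<Sum>u\<in>A. \<Sum>x\<in>UNIV. g u (h y) * pmf Q (u, x, y)) \<le> V y * d" for y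
      proof -
        have hy: "h y \<in> W" using h by auto
        have "expected_gain Q g (\<lambda>_. h y) \<le> ereal d"
          unfolding real[symmetric] D_def by (intro SUP_upper hy)
        then have le: "(\<Sum>y'\<in>UNIV. \<Sum>u\<in>A. \<Sum>x\<in>UNIV. g u (h y) * pmf Q (u, x, y')) \<le> d"
          by (simp add: expected_gain_eq_sum[OF A])
        have "(\<Sum>u\<in>A. \<Sum>x\<in>UNIV. g u (h y) * pmf Q (u, x, y))
            \<le> (\<Sum>u\<in>A. \<Sum>x\<in>UNIV. g u (h y) * ((\<Sum>y'\<in>UNIV. pmf Q (u, x, y')) * V y))"
          unfolding V_def using g hy
          by (intro sum_mono mult_left_mono markov_chain_joint_le[OF A P[symmetric] Q]) auto
        also have "\<dots> = V y * (\<Sum>u\<in>A. \<Sum>x\<in>UNIV. \<Sum>y'\<in>UNIV. g u (h y) * pmf Q (u, x, y'))"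
          by (simp add: sum_distrib_left sum_distrib_right mult_ac)
        also have "(\<Sum>u\<in>A. \<Sum>x\<in>UNIV. \<Sum>y'\<in>UNIV. g u (h y) * pmf Q (u, x, y')) =
            (\<Sum>y'\<in>UNIV. \<Sum>u\<in>A. \<Sum>x\<in>UNIV. g u (h y) * pmf Q (u, x, y'))"
          by (subst sum.swap[of _ UNIV UNIV], subst sum.swap[of _ UNIV A]) simp
        also have "V y * \<dots> \<le> V y * d"
          by (intro mult_left_mono le) (simp add: V_def maximal_likelihood_nonneg)
        finally show ?thesis .
      qed
      then show ?thesis
        by (simp add: expected_gain_eq_sum[OF A] sum_distrib_right sum_mono)
    qed
    then have "(SUP h\<in>{h. range h \<subseteq> W}. expected_gain Q g h) \<le> ereal ((\<Sum>y\<in>UNIV. V y) * d)"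
      by (intro SUP_least) auto
    then have "(SUP h\<in>{h. range h \<subseteq> W}. expected_gain Q g h) / D \<le> ereal ((\<Sum>y\<in>UNIV. V y) * d) / D"
      using d real by (intro ereal_divide_right_mono) auto
    then show ?thesis using d real by simp
  next
    \<comment> \<open>Division by infinity gives 0 in \<open>ereal\<close>, even for an infinite
      numerator, and the right-hand side is nonnegative.\<close>
    case PInf
    then show ?thesis by (simp add: V_def maximal_likelihood_nonneg sum_nonneg)
  next
    case MInf
    with pos show ?thesis by (simp add: D_def)
  qed
  then show "ext_ln ((SUP h\<in>{h. range h \<subseteq> W}. expected_gain Q g h) / (SUP w\<in>W. expected_gain Q g (\<lambda>_. w)))
      \<le> ext_ln (ereal (\<Sum>y\<in>UNIV. maximal_likelihood (map_pmf (\<lambda>(u, x, y). (x, y)) Q) y))"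
    unfolding D_def V_def P by (rule ext_ln_mono)
qed

section \<open>Guessing \<open>U\<close> as a gain problem\<close>

text \<open>Maximal leakage admits randomised guesses, whereas gain leakage admits only functions of
  \<open>Y\<close>; this bound passes from the former to the latter. The hypothesis on
  \<open>m\<close> says that \<open>m y\<close> is a maximum a posteriori guess.\<close>

lemma prob_guess_le:
  fixes Q :: "(nat \<times> 'x::finite \<times> 'y::finite \<times> nat) pmf"
  assumes A: "finite A" "set_pmf Q \<subseteq> A \<times> UNIV \<times> UNIV \<times> A" and Q: "markov_chain4 Q"
    and m: "\<And>u y. u \<in> A \<Longrightarrow> (\<Sum>x\<in>UNIV. pmf (map_pmf (\<lambda>(u, x, y, u'). (u, x, y)) Q) (u, x, y))
        \<le> (\<Sum>x\<in>UNIV. pmf (map_pmf (\<lambda>(u, x, y, u'). (u, x, y)) Q) (m y, x, y))"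
  shows "measure_pmf.prob Q {(u, x, y, u'). u = u'} \<le>
    (\<Sum>y\<in>UNIV. \<Sum>x\<in>UNIV. pmf (map_pmf (\<lambda>(u, x, y, u'). (u, x, y)) Q) (m y, x, y))"
proof -
  \<comment> \<open>Grouping \<open>(U, X)\<close> into one coordinate turns the second half of
    \<open>markov_chain4\<close> into a statement about a triple, to which
    \<open>pmf_marginals\<close> applies.\<close>
  define Q' where "Q' = map_pmf (\<lambda>(u, x, y, u'). ((u, x), y, u')) Q"
  define R where "R = map_pmf (\<lambda>(u, x, y, u'). (u, x, y)) Q"
  define py where "py = pmf (map_pmf (\<lambda>(a, y, u'). y) Q')"
  define pu where "pu = (\<lambda>y u. pmf (map_pmf (\<lambda>(a, y, u'). (y, u')) Q') (y, u))"
  have Q'A: "set_pmf Q' \<subseteq> (A \<times> UNIV) \<times> UNIV \<times> A"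
    using A(2) by (fastforce simp: Q'_def)
  have fin: "finite (A \<times> (UNIV :: 'x set))" using A by simp
  have Q'Q: "pmf Q' ((u, x), y, u') = pmf Q (u, x, y, u')" for u x y u'
    using pmf_map_inj'[of "\<lambda>(u, x, y, u'). ((u, x), y, u')" Q "(u, x, y, u')"]
    by (simp add: Q'_def inj_def)
  have RQ': "map_pmf (\<lambda>(a, y, u'). (a, y)) Q' = map_pmf (\<lambda>(u, x, y). ((u, x), y)) R"
    by (simp add: Q'_def R_def pmf.map_comp o_def case_prod_unfold)
  have RR: "pmf (map_pmf (\<lambda>(u, x, y). ((u, x), y)) R) ((u, x), y) = pmf R (u, x, y)" for u x y
    using pmf_map_inj'[of "\<lambda>(u, x, y). ((u, x), y)" R "(u, x, y)"] by (simp add: inj_def)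
  have mc: "pmf Q (u, x, y, u') * py y = pmf R (u, x, y) * pu y u'" for u x y u'
    using Q unfolding markov_chain4_def Q'_def[symmetric] markov_chain_def RQ' RR py_def pu_def
    by (metis Q'Q RR)
  have py: "py y = (\<Sum>u\<in>A. pu y u)" for y
    unfolding py_def pu_def pmf_marginals(1)[OF fin A(1) Q'A] pmf_marginals(3)[OF fin A(1) Q'A]
    by (rule sum.swap)
  have pu0: "pu y u \<ge> 0" for y u by (simp add: pu_def)
  \<comment> \<open>Outcomes outside the support are null, so the event can be replaced by a finite
    set indexed by \<open>(y, u, x)\<close>.\<close>
  have "measure_pmf.prob Q {(u, x, y, u'). u = u'} =
      measure_pmf.prob Q ((\<lambda>(y, u, x). (u, x, y, u)) ` (UNIV \<times> A \<times> UNIV))"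
    by (rule measure_prob_cong_0) (use A(2) in \<open>force simp: set_pmf_iff image_iff\<close>)+
  also have "\<dots> = (\<Sum>(y, u, x)\<in>UNIV \<times> A \<times> UNIV. pmf Q (u, x, y, u))"
    using A(1) by (simp add: measure_measure_pmf_finite sum.reindex inj_on_def case_prod_unfold)
  also have "\<dots> = (\<Sum>y\<in>UNIV. \<Sum>u\<in>A. \<Sum>x\<in>UNIV. pmf Q (u, x, y, u))"
    by (simp add: sum.cartesian_product)
  \<comment> \<open>Given \<open>Y = y\<close>, the guess is independent of \<open>U\<close>, so it is no better than the constant guess \<open>m y\<close>.\<close>
  also have "\<dots> \<le> (\<Sum>y\<in>UNIV. \<Sum>x\<in>UNIV. pmf R (m y, x, y))"
  proof (rule sum_mono)
    fix y
    have nn: "(\<Sum>x\<in>UNIV. pmf R (m y, x, y)) \<ge> 0" by (simp add: sum_nonneg)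
    show "(\<Sum>u\<in>A. \<Sum>x\<in>UNIV. pmf Q (u, x, y, u)) \<le> (\<Sum>x\<in>UNIV. pmf R (m y, x, y))"
    \<comment> \<open>The identity \<open>mc\<close> carries the factor \<open>py y\<close>, so it
      says nothing about \<open>Q\<close> where this is zero. There the terms on the left vanish,
      being parts of a zero sum of nonnegative terms.\<close>
    proof (cases "py y = 0")
      case True
      then have "pmf Q (u, x, y, u) = 0" if "u \<in> A" for u x
      proof -
        have "py y = (\<Sum>a\<in>A \<times> UNIV. \<Sum>u'\<in>A. pmf Q' (a, y, u'))"
          unfolding py_def by (rule pmf_marginals(1)[OF fin A(1) Q'A])
        with True A(1) that show ?thesis
          by (auto simp: sum_nonneg_eq_0_iff sum_nonneg Q'Q)
      qed
      then show ?thesis using nn by simp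
    next
      case False
      then have pos: "py y > 0" by (simp add: py_def pmf_nonneg order.not_eq_order_implies_strict)
      have "(\<Sum>u\<in>A. \<Sum>x\<in>UNIV. pmf Q (u, x, y, u)) * py y =
          (\<Sum>u\<in>A. (\<Sum>x\<in>UNIV. pmf R (u, x, y)) * pu y u)"
        by (simp add: sum_distrib_right mc)
      also have "\<dots> \<le> (\<Sum>u\<in>A. (\<Sum>x\<in>UNIV. pmf R (m y, x, y)) * pu y u)"
        unfolding R_def by (intro sum_mono mult_right_mono m pu0)
      also have "\<dots> = (\<Sum>x\<in>UNIV. pmf R (m y, x, y)) * py y"
        by (simp add: py sum_distrib_left)
      finally show ?thesis using pos by simp
    qed
  qed
  finally show ?thesis unfolding R_def .
qed

lemma maximal_leakage_le_gain:
  fixes P :: "('x::finite \<times> 'y::finite) pmf"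
  shows "maximal_leakage P \<le> maximal_gain_leakage TYPE('b::infinite) P"
  unfolding maximal_leakage_def
proof (rule Sup_least, clarsimp simp only: mem_Collect_eq)
  fix A :: "nat set" and Q :: "(nat \<times> 'x \<times> 'y \<times> nat) pmf"
  assume A: "finite A" "set_pmf Q \<subseteq> A \<times> UNIV \<times> UNIV \<times> A" and Q: "markov_chain4 Q"
  define R where "R = map_pmf (\<lambda>(u, x, y, u'). (u, x, y)) Q"
  define pU where "pU = pmf (map_pmf fst Q)"
  define M where "M = Max (pU ` A)"
  have RA: "set_pmf R \<subseteq> A \<times> UNIV \<times> UNIV" using A(2) by (fastforce simp: R_def)
  have A0: "A \<noteq> {}" using A(2) set_pmf_not_empty[of Q] by auto
  have pU: "pU u = (\<Sum>y\<in>UNIV. \<Sum>x\<in>UNIV. pmf R (u, x, y))" for u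
  proof -
    have "map_pmf fst Q = map_pmf fst R"
      by (simp add: R_def pmf.map_comp o_def case_prod_unfold)
    then have "pU u = (\<Sum>s\<in>UNIV \<times> UNIV. pmf R ((\<lambda>(y, x). (u, x, y)) s))"
      unfolding pU_def by simp (rule pmf_map_eq_sum, auto simp: inj_on_def image_iff)
    then show ?thesis by (simp add: sum.cartesian_product case_prod_unfold UNIV_Times_UNIV[symmetric] del: UNIV_Times_UNIV)
  qed
  \<comment> \<open>\<open>A\<close> may contain null values of \<open>U\<close>, but it also
    contains the support of \<open>U\<close>, which is non-empty.\<close>
  have M_pos: "M > 0"
  proof -
    obtain u where u: "u \<in> set_pmf (map_pmf fst Q)" using set_pmf_not_empty[of "map_pmf fst Q"] by blast
    then have "u \<in> A" using A(2) by auto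
    then have "pU u \<le> M" unfolding M_def using A(1) by (intro Max_ge) auto
    moreover have "pU u > 0" using u unfolding pU_def by (rule pmf_positive)
    ultimately show ?thesis by simp
  qed
  obtain f :: "nat \<Rightarrow> 'b" where f: "inj f"
    using infinite_countable_subset[OF infinite_UNIV] by blast
  define g where "g = (\<lambda>u w. if w = f u then 1 else (0::real))"
  have "\<exists>v\<in>A. \<forall>u\<in>A. (\<Sum>x\<in>UNIV. pmf R (u, x, y)) \<le> (\<Sum>x\<in>UNIV. pmf R (v, x, y))" for y
    using ex_is_arg_min_if_finite[OF A(1) A0, of "\<lambda>u. - (\<Sum>x\<in>UNIV. pmf R (u, x, y))"]
    by (auto simp: is_arg_min_linorder)
  then obtain m where m: "m y \<in> A"
    "u \<in> A \<Longrightarrow> (\<Sum>x\<in>UNIV. pmf R (u, x, y)) \<le> (\<Sum>x\<in>UNIV. pmf R (m y, x, y))" for u y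
    by metis
  have gain: "expected_gain R g (\<lambda>y. f (k y)) = ereal (\<Sum>y\<in>UNIV. \<Sum>x\<in>UNIV. pmf R (k y, x, y))"
    if "\<And>y. k y \<in> A" for k
  proof -
    have "(\<Sum>u\<in>A. \<Sum>x\<in>UNIV. g u (f (k y)) * pmf R (u, x, y)) = (\<Sum>x\<in>UNIV. pmf R (k y, x, y))" for y
    proof -
      have "(\<Sum>u\<in>A. \<Sum>x\<in>UNIV. g u (f (k y)) * pmf R (u, x, y)) =
          (\<Sum>u\<in>A. if u = k y then \<Sum>x\<in>UNIV. pmf R (k y, x, y) else 0)"
        using f by (intro sum.cong) (auto simp: g_def inj_eq)
      then show ?thesis using A(1) that[of y] by simp
    qed
    then show ?thesis by (simp add: expected_gain_eq_sum[OF A(1) RA])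
  qed
  have D: "(SUP w\<in>f ` A. expected_gain R g (\<lambda>_. w)) = ereal M"
  proof -
    have "(SUP w\<in>f ` A. expected_gain R g (\<lambda>_. w)) = (SUP u\<in>A. ereal (pU u))"
      unfolding image_image by (rule SUP_cong) (simp_all add: gain pU)
    also have "\<dots> = ereal M"
    proof (rule antisym)
      show "(SUP u\<in>A. ereal (pU u)) \<le> ereal M"
        unfolding M_def using A(1) by (intro SUP_least) simp
      have "M \<in> pU ` A" unfolding M_def using A(1) A0 by (intro Max_in) auto
      then show "ereal M \<le> (SUP u\<in>A. ereal (pU u))" by (auto intro: SUP_upper)
    qed
    finally show ?thesis .
  qed
  have "measure_pmf.prob Q {(u, x, y, u'). u = u'} \<le> (\<Sum>y\<in>UNIV. \<Sum>x\<in>UNIV. pmf R (m y, x, y))"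
    using prob_guess_le[OF A Q, of m] m(2) unfolding R_def by blast
  also have "ereal \<dots> = expected_gain R g (\<lambda>y. f (m y))"
    by (rule gain[symmetric]) (rule m)
  also have "\<dots> \<le> (SUP h\<in>{h. range h \<subseteq> f ` A}. expected_gain R g h)"
    using m(1) by (intro SUP_upper) auto
  finally have "ereal (measure_pmf.prob Q {(u, x, y, u'). u = u'}) / ereal M
      \<le> (SUP h\<in>{h. range h \<subseteq> f ` A}. expected_gain R g h) / (SUP w\<in>f ` A. expected_gain R g (\<lambda>_. w))"
    unfolding D using M_pos by (intro ereal_divide_right_mono) auto
  then have "ext_ln (ereal (measure_pmf.prob Q {(u, x, y, u'). u = u'} / M)) \<le>
      ext_ln ((SUP h\<in>{h. range h \<subseteq> f ` A}. expected_gain R g h) / (SUP w\<in>f ` A. expected_gain R g (\<lambda>_. w)))"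
    using M_pos by (intro ext_ln_mono) simp
  also have "\<dots> \<le> maximal_gain_leakage TYPE('b) (map_pmf (\<lambda>(u, x, y, u'). (x, y)) Q)"
    unfolding maximal_gain_leakage_def
  proof (rule Sup_upper, rule CollectI, intro exI conjI)
    show "map_pmf (\<lambda>(u, x, y). (x, y)) R = map_pmf (\<lambda>(u, x, y, u'). (x, y)) Q"
      by (simp add: R_def pmf.map_comp o_def case_prod_unfold)
    show "markov_chain R" using Q by (simp add: markov_chain4_def R_def)
    show "0 < (SUP w\<in>f ` A. expected_gain R g (\<lambda>_. w))" using D M_pos by simp
  qed (use A RA A0 in \<open>auto simp: g_def\<close>)
  finally show "ext_ln (ereal (measure_pmf.prob Q {(u, x, y, u'). u = u'} / Max (pmf (map_pmf fst Q) ` A)))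
      \<le> maximal_gain_leakage TYPE('b) (map_pmf (\<lambda>(u, x, y, u'). (x, y)) Q)"
    unfolding M_def pU_def .
qed

section \<open>A refinement of \<open>X\<close> that reaches the upper bound\<close>

text \<open>This serves as the conditional law of the piece index given \<open>X = x\<close>.
  Building it as a mixture makes normalisation automatic.\<close>

definition spike_pmf :: "real \<Rightarrow> nat \<Rightarrow> nat pmf" where
  "spike_pmf c n =
     bind_pmf (bernoulli_pmf c) (\<lambda>b. if b then return_pmf 0 else pmf_of_set {1..n})"

lemma pmf_spike_pmf:
  assumes "0 \<le> c" "c \<le> 1" "0 < n"
  shows "pmf (spike_pmf c n) j = (if j = 0 then c else if j \<le> n then (1 - c) / n else 0)"
  using assms by (auto simp: spike_pmf_def pmf_bind indicator_def)

lemma maximal_leakage_ge: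
  fixes P :: "('x::finite \<times> 'y::finite) pmf"
  shows "ext_ln (\<Sum>y\<in>UNIV. maximal_likelihood P y) \<le> maximal_leakage P"
proof -
  \<comment> \<open>\<open>U\<close> refines \<open>X\<close>: it encodes \<open>(X, j)\<close>, where \<open>j = 0\<close> with joint probability exactly \<open>p\<close> for
    every \<open>x\<close> in the support, and the rest of the mass at \<open>x\<close> is split into pieces of size at most \<open>p\<close>.
    The guess is \<open>(s y, 0)\<close>, where \<open>s y\<close> is the maximum likelihood estimate of \<open>X\<close>.\<close>
  define pX where "pX = pmf (map_pmf fst P)"
  define S where "S = set_pmf (map_pmf fst P)"
  define p where "p = Min (pX ` S)"
  \<comment> \<open>With \<open>1 / n\<close> at most \<open>p\<close>, a piece of index 1 to
    \<open>n\<close> has joint probability \<open>(pX x - p) / n\<close>, hence at most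
    \<open>p\<close>.\<close>
  define n where "n = nat \<lceil>1 / p\<rceil>"
  define J where "J x = spike_pmf (if x \<in> S then p / pX x else 0) n" for x
  have S: "finite S" "S \<noteq> {}" by (auto simp: S_def set_pmf_not_empty)
  have p_le: "p \<le> pX x" if "x \<in> S" for x unfolding p_def using that S by (intro Min_le) auto
  have "p \<in> pX ` S" unfolding p_def using S by (intro Min_in) auto
  then have p: "0 < p" unfolding pX_def S_def by (blast intro: pmf_positive)
  then have n: "1 / p \<le> n" "0 < n" by (simp_all add: n_def of_nat_ceiling)
  have pX0: "pX x = 0" if "x \<notin> S" for x using that unfolding pX_def S_def set_pmf_iff by blast
  have pXp: "0 < pX x" if "x \<in> S" for x using that unfolding pX_def S_def by (rule pmf_positive)
  have J: "pmf (J x) j = (let c = if x \<in> S then p / pX x else 0 in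
      if j = 0 then c else if j \<le> n then (1 - c) / n else 0)" for x j
    unfolding J_def Let_def using p p_le[of x] pXp[of x] n(2) by (intro pmf_spike_pmf) auto
  have J_le: "pX x * pmf (J x) j \<le> p" for x j
  proof (cases "x \<in> S \<and> j \<noteq> 0 \<and> j \<le> n")
    case True
    have "pX x * pmf (J x) j = (pX x - p) / n"
      using True pXp[of x] n(2) by (simp add: J Let_def field_simps)
    also have "\<dots> \<le> 1 / n" using p pmf_le_1[of "map_pmf fst P" x]
      by (intro divide_right_mono) (auto simp: pX_def)
    also have "\<dots> \<le> p" using n p by (simp add: field_simps)
    finally show ?thesis .
  next
    \<comment> \<open>For \<open>x\<close> outside \<open>S\<close> the product is 0, for
      \<open>j = 0\<close> in \<open>S\<close> it is \<open>p\<close>, and for \<open>j\<close>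
      above \<open>n\<close> it is 0.\<close>
    case False
    then show ?thesis using p pX0[of x] pXp[of x] by (auto simp: J Let_def)
  qed
  define e :: "'x \<times> nat \<Rightarrow> nat" where "e = to_nat"
  have e: "e a = e b \<longleftrightarrow> a = b" for a b by (simp add: e_def)
  define k where "k x = map_pmf (\<lambda>j. e (x, j)) (J x)" for x
  have k_same: "pmf (k x) (e (x, j)) = pmf (J x) j" for x j
    unfolding k_def by (rule pmf_map_inj') (simp add: inj_def e)
  have k_other: "pmf (k x) (e (x', j)) = 0" if "x \<noteq> x'" for x x' j
    using that by (auto simp: k_def set_pmf_iff[symmetric] e pmf_eq_0_set_pmf)
  obtain s where s: "s y \<in> S" "maximal_likelihood P y = pmf P (s y, y) / pX (s y)" for y
    unfolding S_def pX_def using maximal_likelihood_attained by metis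
  define t where "t y = e (s y, 0)" for y
  define A where "A = e ` (UNIV \<times> {..n})"
  define Q where "Q = bind_pmf P (\<lambda>(x, y). map_pmf (\<lambda>u. (u, x, y, t y)) (k x))"
  have A: "finite A" by (simp add: A_def)
  have kA: "set_pmf (k x) \<subseteq> A" for x
  proof -
    have "j \<le> n" if "j \<in> set_pmf (J x)" for j
      using that by (auto simp: set_pmf_iff J Let_def split: if_splits)
    then show ?thesis by (auto simp: k_def A_def)
  qed
  have tA: "t y \<in> A" for y by (auto simp: t_def A_def)
  have QA: "set_pmf Q \<subseteq> A \<times> UNIV \<times> UNIV \<times> A"
    using kA tA by (fastforce simp: Q_def)
  have QP: "map_pmf (\<lambda>(u, x, y, u'). (x, y)) Q = P"
    by (simp add: Q_def map_bind_pmf pmf.map_comp o_def case_prod_unfold map_pmf_const bind_return_pmf')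
  have pmfQ: "pmf Q (u, x, y, u') = pmf P (x, y) * pmf (k x) u * (if u' = t y then 1 else 0)" for u x y u'
  proof -
    have inner: "pmf (map_pmf (\<lambda>u. (u, x1, y1, t y1)) (k x1)) (u, x, y, u') =
        (if (x1, y1) = (x, y) then pmf (k x) u * (if u' = t y then 1 else 0) else 0)" for x1 y1
    proof (cases "x1 = x \<and> y1 = y \<and> u' = t y")
      case True
      then show ?thesis
        using pmf_map_inj'[of "\<lambda>u. (u, x, y, t y)" "k x" u] by (simp add: inj_def)
    next
      case False
      then show ?thesis by (auto simp: pmf_eq_0_set_pmf)
    qed
    have "pmf Q (u, x, y, u') = (\<Sum>a\<in>UNIV. pmf (case a of (x, y) \<Rightarrow> map_pmf (\<lambda>u. (u, x, y, t y)) (k x)) (u, x, y, u') * pmf P a)"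
      unfolding Q_def pmf_bind by (rule integral_measure_pmf_real) auto
    also have "\<dots> = (\<Sum>a\<in>UNIV. if a = (x, y) then pmf P (x, y) * pmf (k x) u * (if u' = t y then 1 else 0) else 0)"
      by (intro sum.cong) (auto simp: inner split: if_splits)
    finally show ?thesis by simp
  qed
  \<comment> \<open>Given \<open>x\<close>, the value \<open>u\<close> is drawn without regard to
    \<open>y\<close>, and the guess is a function of \<open>y\<close>. So the law of
    \<open>(U, X, Y)\<close> factors at \<open>x\<close>, and the full law factors at
    \<open>y\<close>.\<close>
  have mc: "markov_chain4 Q"
    unfolding markov_chain4_def
  proof
    have "pmf (map_pmf (\<lambda>(u, x, y, u'). (u, x, y)) Q) (u, x, y) = pmf (k x) u * pmf P (x, y)" for u x y
    proof -
      have "pmf (map_pmf (\<lambda>(u, x, y, u'). (u, x, y)) Q) (u, x, y) = (\<Sum>u'\<in>A. pmf Q (u, x, y, u'))"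
        by (rule pmf_map_eq_sum) (use A QA in \<open>auto simp: inj_on_def\<close>)
      then show ?thesis using A tA by (simp add: pmfQ sum_distrib_left[symmetric])
    qed
    then show "markov_chain (map_pmf (\<lambda>(u, x, y, u'). (u, x, y)) Q)"
      by (intro markov_chain_factor[of A UNIV _ "\<lambda>u x. pmf (k x) u" "\<lambda>x y. pmf P (x, y)"])
         (use A QA in fastforce)+
    have "pmf (map_pmf (\<lambda>(u, x, y, u'). ((u, x), y, u')) Q) ((u, x), y, u') = pmf Q (u, x, y, u')" for u x y u'
      using pmf_map_inj'[of "\<lambda>(u, x, y, u'). ((u, x), y, u')" Q "(u, x, y, u')"] by (simp add: inj_def)
    then show "markov_chain (map_pmf (\<lambda>(u, x, y, u'). ((u, x), y, u')) Q)"
      by (intro markov_chain_factor[of "A \<times> UNIV" A _ "\<lambda>(u, x) y. pmf P (x, y) * pmf (k x) u"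
            "\<lambda>y u'. if u' = t y then 1 else 0"])
         (use A QA in \<open>fastforce simp: pmfQ\<close>)+
  qed
  \<comment> \<open>By injectivity of \<open>e\<close>, the value \<open>e (x0, j)\<close> can only
    arise from \<open>X = x0\<close>, so \<open>J_le\<close> bounds its probability.\<close>
  have pU: "pmf (map_pmf fst Q) u \<le> p" if "u \<in> A" for u
  proof -
    obtain x0 j where u: "u = e (x0, j)" using \<open>u \<in> A\<close> by (auto simp: A_def)
    have "map_pmf fst Q = bind_pmf (map_pmf fst P) k"
      by (simp add: Q_def map_bind_pmf bind_map_pmf pmf.map_comp o_def case_prod_unfold)
    then have "pmf (map_pmf fst Q) u = (\<Sum>x\<in>UNIV. pmf (k x) u * pX x)"
      unfolding pX_def by (simp only: pmf_bind) (rule integral_measure_pmf_real, auto)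
    also have "\<dots> = (\<Sum>x\<in>UNIV. if x = x0 then pX x0 * pmf (J x0) j else 0)"
      by (intro sum.cong) (auto simp: u k_same k_other)
    finally show ?thesis using J_le by simp
  qed
  define M where "M = Max (pmf (map_pmf fst Q) ` A)"
  have M_pos: "M > 0"
  proof -
    obtain u where u: "u \<in> set_pmf (map_pmf fst Q)" using set_pmf_not_empty[of "map_pmf fst Q"] by blast
    then have "u \<in> A" using QA by auto
    then have "pmf (map_pmf fst Q) u \<le> M" unfolding M_def using A by (intro Max_ge) auto
    with pmf_positive[OF u] show ?thesis by simp
  qed
  have Mp: "M \<le> p" unfolding M_def using A pU tA by (subst Max_le_iff) auto
  \<comment> \<open>For each \<open>y\<close>, the outcome with \<open>X = s y\<close> and piece 0
    is a correct guess. Its probability is \<open>pmf P (s y, y) * (p / pX (s y))\<close>, which is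
    \<open>p\<close> times the maximal likelihood; these outcomes differ for different
    \<open>y\<close>.\<close>
  have "p * (\<Sum>y\<in>UNIV. maximal_likelihood P y) = (\<Sum>y\<in>UNIV. pmf Q (t y, s y, y, t y))"
    unfolding sum_distrib_left
    by (intro sum.cong) (use s in \<open>auto simp: pmfQ t_def k_same J\<close>)
  also have "\<dots> = measure_pmf.prob Q ((\<lambda>y. (t y, s y, y, t y)) ` UNIV)"
    by (simp add: measure_measure_pmf_finite sum.reindex inj_on_def)
  also have "\<dots> \<le> measure_pmf.prob Q {(u, x, y, u'). u = u'}"
    by (intro measure_pmf.finite_measure_mono) auto
  finally have prob: "p * (\<Sum>y\<in>UNIV. maximal_likelihood P y) \<le> measure_pmf.prob Q {(u, x, y, u'). u = u'}" .
  \<comment> \<open>The bound \<open>Mp\<close> suffices: a smaller denominator \<open>M\<close>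
    only increases the quotient.\<close>
  have "M * (\<Sum>y\<in>UNIV. maximal_likelihood P y) \<le> p * (\<Sum>y\<in>UNIV. maximal_likelihood P y)"
    by (intro mult_right_mono Mp sum_nonneg maximal_likelihood_nonneg)
  with prob have "(\<Sum>y\<in>UNIV. maximal_likelihood P y) \<le> measure_pmf.prob Q {(u, x, y, u'). u = u'} / M"
    using M_pos by (simp add: field_simps)
  then have "ext_ln (\<Sum>y\<in>UNIV. maximal_likelihood P y) \<le>
      ext_ln (ereal (measure_pmf.prob Q {(u, x, y, u'). u = u'} / M))"
    by (intro ext_ln_mono) simp
  also have "\<dots> \<le> maximal_leakage P"
    unfolding maximal_leakage_def M_def
    by (rule Sup_upper) (use A QA QP mc in blast)
  finally show ?thesis .
qed

theorem theorem5:
  fixes P :: "('x::finite \<times> 'y::finite) pmf"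
  shows "maximal_leakage P = maximal_gain_leakage TYPE('b::infinite) P"
  by (rule antisym[OF maximal_leakage_le_gain
        order_trans[OF maximal_gain_leakage_le maximal_leakage_ge]])

end
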